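(* Let $G$ be an ordered graph with at least one edge. Then either $sat_{<}(n,G)=O(1)$ or $sat_{<}(n,G)=\Theta(n)$ (as $n\to\infty$).
   Context: An ordered graph is a finite simple graph whose vertex set is linearly ordered; an ordered graph on $m$ vertices is identified with one on vertex set $[m]=\{1,\dots,m\}$ with the natural order. An ordered graph $H$ contains an ordered graph $G$ (contains a copy of $G$) if there is an injective order-preserving map $\varphi:V(G)\to V(H)$ such that $\varphi(u)\varphi(v)\in E(H)$ for every $uv\in E(G)$; otherwise $H$ avoids $G$. An ordered graph $H$ saturates $G$ if $H$ avoids $G$ but for every pair of distinct non-adjacent vertices $x,y$ of $H$ the graph $H+xy$ contains $G$. For an ordered graph $G$ with at least one edge, $sat_{<}(n,G)$ is the minimum number of edges of an ordered graph on $n$ vertices that saturates $G$. *)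

theory Defs
  imports Complex_Main "HOL-Library.Landau_Symbols"
begin

record ordered_graph =
  order :: nat
  edges :: "nat set set"

definition vertices :: "ordered_graph \<Rightarrow> nat set" where
  "vertices G = {1..order G}"

definition wf_ordered_graph :: "ordered_graph \<Rightarrow> bool" where
  "wf_ordered_graph G \<longleftrightarrow> (\<forall>e\<in>edges G. e \<subseteq> vertices G \<and> card e = 2)"

definition add_edge :: "ordered_graph \<Rightarrow> nat \<Rightarrow> nat \<Rightarrow> ordered_graph" where
  "add_edge H x y = H\<lparr>edges := insert {x, y} (edges H)\<rparr>"

definition contains :: "ordered_graph \<Rightarrow> ordered_graph \<Rightarrow> bool" where
  "contains H G \<longleftrightarrow> (\<exists>\<phi>. \<phi> ` vertices G \<subseteq> vertices H \<and> strict_mono_on (vertices G) \<phi> \<and>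
     (\<forall>u v. {u, v} \<in> edges G \<longrightarrow> {\<phi> u, \<phi> v} \<in> edges H))"

definition saturates :: "ordered_graph \<Rightarrow> ordered_graph \<Rightarrow> bool" where
  "saturates H G \<longleftrightarrow> \<not> contains H G \<and>
     (\<forall>x\<in>vertices H. \<forall>y\<in>vertices H. x \<noteq> y \<and> {x, y} \<notin> edges H \<longrightarrow> contains (add_edge H x y) G)"

definition sat :: "nat \<Rightarrow> ordered_graph \<Rightarrow> nat" where
  "sat n G = (LEAST k. \<exists>H. wf_ordered_graph H \<and> order H = n \<and> saturates H G \<and> card (edges H) = k)"

lemma finite_edges:
  assumes "wf_ordered_graph H"
  shows "finite (edges H)"
proof (rule finite_subset)
  show "edges H \<subseteq> Pow (vertices H)"
    using assms by (auto simp: wf_ordered_graph_def)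
  show "finite (Pow (vertices H))"
    by (simp add: vertices_def)
qed

lemma saturating_graph_exists:
  assumes "wf_ordered_graph G" "edges G \<noteq> {}"
  shows "\<exists>H. wf_ordered_graph H \<and> order H = n \<and> saturates H G"
proof -
  define S where "S = {E. E \<subseteq> Pow {1..n} \<and> wf_ordered_graph \<lparr>order = n, edges = E\<rparr> \<and>
    \<not> contains \<lparr>order = n, edges = E\<rparr> G}"
  obtain u v where uv: "{u, v} \<in> edges G"
    using assms unfolding wf_ordered_graph_def card_2_iff by (metis ex_in_conv)
  have "finite S"
    by (rule finite_subset[of _ "Pow (Pow {1..n})"]) (auto simp: S_def)
  moreover have "{} \<in> S"
    using uv by (auto simp: S_def wf_ordered_graph_def contains_def)
  ultimately obtain E where E: "E \<in> S" "\<And>F. F \<in> S \<Longrightarrow> E \<subseteq> F \<Longrightarrow> F = E"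
    using finite_has_maximal[of S] by (metis empty_iff)
  let ?H = "\<lparr>order = n, edges = E\<rparr>"
  have "contains (add_edge ?H x y) G"
    if xy: "x \<in> vertices ?H" "y \<in> vertices ?H" "x \<noteq> y" "{x, y} \<notin> E" for x y
  proof (rule ccontr)
    assume "\<not> contains (add_edge ?H x y) G"
    with xy E(1) have "insert {x, y} E \<in> S"
      by (auto simp: S_def add_edge_def wf_ordered_graph_def vertices_def)
    with E(2)[of "insert {x, y} E"] xy show False by auto
  qed
  with E(1) show ?thesis
    by (intro exI[of _ ?H]) (auto simp: S_def saturates_def)
qed

lemma sat_attained:
  assumes "wf_ordered_graph G" "edges G \<noteq> {}"
  shows "\<exists>H. wf_ordered_graph H \<and> order H = n \<and> saturates H G \<and> card (edges H) = sat n G"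
proof -
  have "\<exists>k H. wf_ordered_graph H \<and> order H = n \<and> saturates H G \<and> card (edges H) = k"
    using saturating_graph_exists[OF assms] by auto
  then show ?thesis
    unfolding sat_def by (rule LeastI_ex)
qed

end

theory Submission
  imports Defs
begin

text \<open>
  Upper bound: let \<open>{u, v}\<close> be a shortest edge of \<open>G\<close>. Join the first \<open>u - 1\<close> and the last
  \<open>order G - v\<close> vertices to all others and leave the rest empty. This graph avoids \<open>G\<close>, as the
  edge \<open>{u, v}\<close> has no place to go, but every further pair at distance at least \<open>v - u\<close> completes
  a copy of \<open>G\<close> in which it plays the role of \<open>{u, v}\<close>. Hence any saturating extension has linearly
  many edges.

  Lower bound: if some saturating graph has \<open>order G\<close> consecutive isolated vertices, a further
  isolated vertex can be inserted among them again and again without losing saturation, so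
  \<open>sat n G\<close> is bounded. Otherwise a positive fraction of the vertices of every saturating graph is
  not isolated.
\<close>

section \<open>Transport of copies, saturating extensions, and positions of vertices in a
  copy\<close>

text \<open>Compose the embeddings. It is applied with \<open>id\<close> for adding edges and with
  \<open>skip t\<close> for adding a vertex.\<close>

lemma contains_map:
  assumes "contains H G" and "f ` vertices H \<subseteq> vertices H'" and "strict_mono_on (vertices H) f"
    and "\<And>u v. {u, v} \<in> edges H \<Longrightarrow> {f u, f v} \<in> edges H'"
  shows "contains H' G"
proof -
  obtain \<phi> where \<phi>: "\<phi> ` vertices G \<subseteq> vertices H" "strict_mono_on (vertices G) \<phi>"
    "\<And>u v. {u, v} \<in> edges G \<Longrightarrow> {\<phi> u, \<phi> v} \<in> edges H"
    using assms(1) unfolding contains_def by blast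
  have "strict_mono_on (vertices G) (f \<circ> \<phi>)"
    using \<phi>(1,2) assms(3) unfolding strict_mono_on_def by (simp add: image_subset_iff)
  with \<phi> assms(2,4) show ?thesis
    unfolding contains_def by (intro exI[of _ "f \<circ> \<phi>"]) (auto simp: image_subset_iff)
qed

lemma contains_mono:
  assumes "contains H G" "order H = order H'" "edges H \<subseteq> edges H'"
  shows "contains H' G"
  by (rule contains_map[OF assms(1), of id])
    (use assms in \<open>auto simp: vertices_def strict_mono_on_def\<close>)

text \<open>Among the finitely many edge sets on the same vertices that avoid \<open>G\<close>, take
  a maximal one above the given one. Starting from a prescribed graph is what the upper bound
  needs.\<close>

lemma saturating_extension_exists:
  assumes "wf_ordered_graph H\<^sub>0" "\<not> contains H\<^sub>0 G"
  obtains H where "wf_ordered_graph H" "order H = order H\<^sub>0" "edges H\<^sub>0 \<subseteq> edges H" "saturates H G"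
proof -
  define n where "n = order H\<^sub>0"
  define S where "S = {E. wf_ordered_graph \<lparr>order = n, edges = E\<rparr> \<and>
    \<not> contains \<lparr>order = n, edges = E\<rparr> G}"
  have "finite S"
    by (rule finite_subset[of _ "Pow (Pow {1..n})"])
      (auto simp: S_def wf_ordered_graph_def vertices_def)
  moreover have "edges H\<^sub>0 \<in> S"
    using assms contains_mono[of "\<lparr>order = n, edges = edges H\<^sub>0\<rparr>" G H\<^sub>0]
    by (auto simp: S_def n_def wf_ordered_graph_def vertices_def)
  ultimately obtain E where E: "E \<in> S" "edges H\<^sub>0 \<subseteq> E" "\<And>F. F \<in> S \<Longrightarrow> E \<subseteq> F \<Longrightarrow> F = E"
    using finite_has_maximal2[of S "edges H\<^sub>0"] by metis
  let ?H = "\<lparr>order = n, edges = E\<rparr>"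
  have "contains (add_edge ?H x y) G"
    if xy: "x \<in> vertices ?H" "y \<in> vertices ?H" "x \<noteq> y" "{x, y} \<notin> E" for x y
  proof (rule ccontr)
    assume "\<not> contains (add_edge ?H x y) G"
    with xy E(1) have "insert {x, y} E \<in> S"
      by (auto simp: S_def add_edge_def wf_ordered_graph_def vertices_def)
    with E(3)[of "insert {x, y} E"] xy show False by auto
  qed
  with E(1,2) that[of ?H] show ?thesis
    by (auto simp: S_def saturates_def n_def)
qed

lemma sat_le:
  assumes "wf_ordered_graph H" "saturates H G"
  shows "sat (order H) G \<le> card (edges H)"
  unfolding sat_def using assms by (intro Least_le) auto

lemma wf_ordered_graph_edgeE:
  assumes "wf_ordered_graph G" "e \<in> edges G"
  obtains x y where "e = {x, y}" "1 \<le> x" "x < y" "y \<le> order G"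
proof -
  have e: "e \<subseteq> {1..order G}" "card e = 2"
    using assms by (auto simp: wf_ordered_graph_def vertices_def)
  then obtain x y where "e = {x, y}" "x \<noteq> y"
    by (auto simp: card_2_iff)
  with e that[of x y] that[of y x] show ?thesis
    by (cases "x < y") (auto simp: insert_commute)
qed

text \<open>The images of 1, ..., i - 1 need room below the image of i. The next lemma is the mirror
  image: the k - i later vertices need room above it.\<close>

lemma strict_mono_on_ge:
  fixes \<phi> :: "nat \<Rightarrow> nat"
  assumes "strict_mono_on {1..k} \<phi>" "\<phi> ` {1..k} \<subseteq> {1..n}" "1 \<le> i" "i \<le> k"
  shows "i \<le> \<phi> i"
  using assms(3,4)
proof (induction i rule: nat_induct_at_least)
  case base
  then have "1 \<in> {1..k}" by simp
  with assms(2) show ?case by force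
next
  case (Suc i)
  then have "\<phi> i < \<phi> (Suc i)"
    by (intro strict_mono_onD[OF assms(1)]) auto
  with Suc show ?case by simp
qed

lemma strict_mono_on_le:
  fixes \<phi> :: "nat \<Rightarrow> nat"
  assumes "strict_mono_on {1..k} \<phi>" "\<phi> ` {1..k} \<subseteq> {1..n}" "1 \<le> i" "i \<le> k"
  shows "\<phi> i + k \<le> n + i"
  using assms(4,3)
proof (induction i rule: inc_induct)
  case base
  then have "k \<in> {1..k}" by simp
  with assms(2) show ?case by force
next
  case (step i)
  then have "\<phi> i < \<phi> (Suc i)"
    by (intro strict_mono_onD[OF assms(1)]) auto
  with step show ?case by simp
qed

section \<open>The linear upper bound\<close>

text \<open>\<open>a\<close> and \<open>c\<close> are the sizes of the initial and final segments
  that are joined to everything. As x < y, it is enough to test the smaller endpoint against the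
  first segment and the larger one against the last.\<close>

definition joined_ends :: "nat \<Rightarrow> nat \<Rightarrow> nat \<Rightarrow> ordered_graph" where
  "joined_ends n a c = \<lparr>order = n,
     edges = {{x, y} | x y. 1 \<le> x \<and> x < y \<and> y \<le> n \<and> (x \<le> a \<or> n < y + c)}\<rparr>"

lemma order_joined_ends [simp]: "order (joined_ends n a c) = n"
  by (simp add: joined_ends_def)

lemma edge_joined_ends:
  assumes "x < y"
  shows "{x, y} \<in> edges (joined_ends n a c) \<longleftrightarrow> 1 \<le> x \<and> y \<le> n \<and> (x \<le> a \<or> n < y + c)"
  using assms by (auto simp: joined_ends_def doubleton_eq_iff)

lemma wf_joined_ends: "wf_ordered_graph (joined_ends n a c)"
  by (auto simp: joined_ends_def wf_ordered_graph_def vertices_def)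

text \<open>In a copy, the image of u has at least u - 1 vertices below it and the image of v at
  least \<open>order G\<close> - v above it. So the image of the edge {u, v} has no endpoint in a
  joined segment.\<close>

lemma joined_ends_avoids:
  assumes "{u, v} \<in> edges G" "1 \<le> u" "u < v" "v \<le> order G"
  shows "\<not> contains (joined_ends n (u - 1) (order G - v)) G"
proof
  assume "contains (joined_ends n (u - 1) (order G - v)) G"
  then obtain \<phi> where \<phi>: "\<phi> ` {1..order G} \<subseteq> {1..n}" "strict_mono_on {1..order G} \<phi>"
    "{\<phi> u, \<phi> v} \<in> edges (joined_ends n (u - 1) (order G - v))"
    using assms(1) unfolding contains_def vertices_def by auto
  have "\<phi> u < \<phi> v"
    using assms by (intro strict_mono_onD[OF \<phi>(2)]) auto
  moreover have "u \<le> \<phi> u"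
    using strict_mono_on_ge[OF \<phi>(2,1), of u] assms by simp
  moreover have "\<phi> v + order G \<le> n + v"
    using strict_mono_on_le[OF \<phi>(2,1), of v] assms by simp
  ultimately show False
    using \<phi>(3) assms by (auto simp: edge_joined_ends)
qed

lemma joined_ends_add_edge:
  assumes "wf_ordered_graph G" "1 \<le> u" "u < v" "v \<le> order G"
    and shortest: "\<And>i j. {i, j} \<in> edges G \<Longrightarrow> i < j \<Longrightarrow> v - u \<le> j - i"
    and xy: "u \<le> x" "x + (v - u) \<le> y" "y + order G \<le> n + v"
  shows "contains (add_edge (joined_ends n (u - 1) (order G - v)) x y) G"
proof -
  let ?k = "order G"
  let ?H = "add_edge (joined_ends n (u - 1) (order G - v)) x y"
  \<comment> \<open>Vertices before u fill the initial segment and those after v the final one. The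
    vertices strictly between u and v follow directly after x; they fit because y - x is at least v
    - u.\<close>
  define \<phi> where "\<phi> i = (if i < u then i else if i < v then x + (i - u)
    else if i = v then y else n + i - ?k)" for i
  have mono: "\<phi> i < \<phi> j" if "1 \<le> i" "i < j" "j \<le> ?k" for i j
    using that assms(2-4) xy by (auto simp: \<phi>_def)
  have range: "1 \<le> \<phi> i \<and> \<phi> i \<le> n" if "1 \<le> i" "i \<le> ?k" for i
    using that assms(2-4) xy by (auto simp: \<phi>_def)
  have edge: "{\<phi> i, \<phi> j} \<in> edges ?H" if ij: "{i, j} \<in> edges G" "1 \<le> i" "i < j" "j \<le> ?k" for i j
  proof (cases "i < u \<or> v < j")
    case True
    then have "\<phi> i \<le> u - 1 \<or> n < \<phi> j + (?k - v)"
    proof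
      assume "i < u"
      then have "\<phi> i = i" by (simp add: \<phi>_def)
      with \<open>i < u\<close> show ?thesis by linarith
    next
      assume "v < j"
      then have "\<phi> j = n + j - ?k" using assms(3) by (simp add: \<phi>_def)
      with \<open>v < j\<close> ij(4) show ?thesis by linarith
    qed
    then show ?thesis
      using mono[OF ij(2-4)] range[of i] range[of j] ij
      by (auto simp: add_edge_def edge_joined_ends)
  next
    case False
    \<comment> \<open>An edge inside the interval from u to v cannot be shorter than v - u, so it is
      {u, v} itself.\<close>
    then have "i = u" "j = v"
      using shortest[OF ij(1,3)] ij assms(2-4) by auto
    then have "\<phi> i = x" "\<phi> j = y"
      using assms(3) by (auto simp: \<phi>_def)
    then show ?thesis
      by (simp add: add_edge_def)
  qed
  have edge': "{\<phi> i, \<phi> j} \<in> edges ?H" if ij: "{i, j} \<in> edges G" for i j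
  proof -
    obtain a b where ab: "{i, j} = {a, b}" "1 \<le> a" "a < b" "b \<le> ?k"
      using wf_ordered_graph_edgeE[OF assms(1) ij] by metis
    then have "{\<phi> i, \<phi> j} = {\<phi> a, \<phi> b}"
      by (auto simp: doubleton_eq_iff)
    then show ?thesis
      using edge[of a b] ab ij by simp
  qed
  have "\<phi> ` {1..?k} \<subseteq> {1..n}"
    using range by auto
  moreover have "strict_mono_on {1..?k} \<phi>"
    using mono by (auto simp: strict_mono_on_def)
  ultimately show ?thesis
    unfolding contains_def using edge'
    by (intro exI[of _ \<phi>]) (auto simp: vertices_def add_edge_def)
qed

text \<open>Each of the three kinds of pairs is coded by one vertex and one parameter with only k
  values, which gives at most k * n pairs of that kind.\<close>

lemma card_edges_near_ends_le:
  fixes E :: "nat set set"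
  assumes "\<And>e. e \<in> E \<Longrightarrow> \<exists>x y. e = {x, y} \<and> 1 \<le> x \<and> x < y \<and> y \<le> n \<and>
    (x \<le> k \<or> n < y + k \<or> y < x + k)"
  shows "card E \<le> 3 * k * n"
proof -
  let ?A = "(\<lambda>(x, y). {x, y}) ` ({1..k} \<times> {1..n})"
  let ?B = "(\<lambda>(x, d). {x, n - d}) ` ({1..n} \<times> {..<k})"
  let ?C = "(\<lambda>(x, d). {x, x + d}) ` ({1..n} \<times> {..<k})"
  have "E \<subseteq> ?A \<union> ?B \<union> ?C"
  proof
    fix e assume "e \<in> E"
    then obtain x y where e: "e = {x, y}" "1 \<le> x" "x < y" "y \<le> n"
      and "x \<le> k \<or> n < y + k \<or> y < x + k"
      using assms by metis
    then consider "x \<le> k" | "n < y + k" | "y < x + k" by blast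
    then show "e \<in> ?A \<union> ?B \<union> ?C"
    proof cases
      case 1
      with e have "e \<in> ?A" by (intro image_eqI[of _ _ "(x, y)"]) auto
      then show ?thesis by blast
    next
      case 2
      with e have "e \<in> ?B" by (intro image_eqI[of _ _ "(x, n - y)"]) auto
      then show ?thesis by blast
    next
      case 3
      with e have "e \<in> ?C" by (intro image_eqI[of _ _ "(x, y - x)"]) auto
      then show ?thesis by blast
    qed
  qed
  then have "card E \<le> card (?A \<union> ?B \<union> ?C)"
    by (intro card_mono) auto
  also have "\<dots> \<le> card ?A + card ?B + card ?C"
    using card_Un_le[of "?A \<union> ?B" ?C] card_Un_le[of ?A ?B] by linarith
  also have "\<dots> \<le> k * n + n * k + n * k"
    by (intro add_mono order_trans[OF card_image_le]) auto
  finally show ?thesis by (simp add: algebra_simps)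
qed

lemma sat_le_linear:
  assumes G: "wf_ordered_graph G" "edges G \<noteq> {}"
  shows "sat n G \<le> 3 * order G * n"
proof -
  define P where "P p \<longleftrightarrow> {fst p, snd p} \<in> edges G \<and> fst p < snd p" for p :: "nat \<times> nat"
  obtain e where "e \<in> edges G" using G(2) by blast
  then obtain i j where "P (i, j)"
    using wf_ordered_graph_edgeE[OF G(1)] unfolding P_def by (metis fst_conv snd_conv)
  then obtain p where p: "P p" "\<And>q. P q \<Longrightarrow> snd p - fst p \<le> snd q - fst q"
    using ex_has_least_nat[of P "(i, j)" "\<lambda>p. snd p - fst p"] by blast
  define u v where "u = fst p" and "v = snd p"
  have uv: "{u, v} \<in> edges G" "u < v"
    and shortest: "\<And>i j. {i, j} \<in> edges G \<Longrightarrow> i < j \<Longrightarrow> v - u \<le> j - i"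
    using p(1) p(2)[of "(_, _)"] by (auto simp: P_def u_def v_def)
  have uv': "1 \<le> u" "v \<le> order G"
    by (rule wf_ordered_graph_edgeE[OF G(1) uv(1)], use uv(2) in \<open>auto simp: doubleton_eq_iff\<close>)+
  let ?H\<^sub>0 = "joined_ends n (u - 1) (order G - v)"
  obtain H where H: "wf_ordered_graph H" "order H = n" "edges ?H\<^sub>0 \<subseteq> edges H" "saturates H G"
    using saturating_extension_exists[OF wf_joined_ends joined_ends_avoids]
      uv uv' by (metis order_joined_ends)
  have "\<exists>x y. e = {x, y} \<and> 1 \<le> x \<and> x < y \<and> y \<le> n \<and>
    (x \<le> order G \<or> n < y + order G \<or> y < x + order G)" if "e \<in> edges H" for e
  proof -
    from wf_ordered_graph_edgeE[OF H(1) that] H(2)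
    obtain x y where e: "e = {x, y}" "1 \<le> x" "x < y" "y \<le> n"
      by metis
    \<comment> \<open>Since e is already an edge of H, adding it to the starting graph stays inside
      H, which avoids \<open>G\<close>.\<close>
    have "\<not> contains (add_edge ?H\<^sub>0 x y) G"
      using contains_mono[of "add_edge ?H\<^sub>0 x y" G H] H that e(1)
      by (auto simp: add_edge_def saturates_def)
    then have "\<not> (u \<le> x \<and> x + (v - u) \<le> y \<and> y + order G \<le> n + v)"
      using joined_ends_add_edge[OF G(1) uv'(1) uv(2) uv'(2) shortest] by blast
    \<comment> \<open>Each failing inequality puts e into one of the three kinds; the sharper bounds
      in u and v are relaxed to \<open>order G\<close> so that a single k serves all of
      them.\<close>
    then show ?thesis
      using e uv' uv by (intro exI[of _ x] exI[of _ y]) auto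
  qed
  then have "card (edges H) \<le> 3 * order G * n"
    by (rule card_edges_near_ends_le)
  then show ?thesis
    using sat_le[OF H(1,4)] H(2) by simp
qed

section \<open>Inserting isolated vertices\<close>

definition isolated_block :: "ordered_graph \<Rightarrow> nat \<Rightarrow> nat \<Rightarrow> bool" where
  "isolated_block H s k \<longleftrightarrow> 1 \<le> s \<and> s + k \<le> Suc (order H) \<and> (\<forall>e\<in>edges H. e \<inter> {s..<s + k} = {})"

definition skip :: "nat \<Rightarrow> nat \<Rightarrow> nat" where
  "skip t x = (if x < t then x else Suc x)"

text \<open>Left inverse of \<open>skip t\<close>. The value at t, which \<open>skip t\<close>
  misses, is a filler: it collides with that of t - 1 for positive t, so uses on vertices first
  ensure that they differ from t.\<close>

definition unskip :: "nat \<Rightarrow> nat \<Rightarrow> nat" where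
  "unskip t x = (if x < t then x else x - 1)"

lemma unskip_skip [simp]: "unskip t (skip t x) = x"
  by (simp add: skip_def unskip_def)

lemma skip_unskip: "x \<noteq> t \<Longrightarrow> skip t (unskip t x) = x"
  by (auto simp: skip_def unskip_def)

lemma inj_skip: "inj (skip t)"
  by (metis injI unskip_skip)

lemma strict_mono_skip: "strict_mono (skip t)"
  by (auto simp: strict_mono_def skip_def)

text \<open>The new vertex is t; it is isolated because \<open>skip t\<close> never takes the value
  t.\<close>

definition insert_vertex :: "ordered_graph \<Rightarrow> nat \<Rightarrow> ordered_graph" where
  "insert_vertex H t = \<lparr>order = Suc (order H), edges = (`) (skip t) ` edges H\<rparr>"

lemma order_insert_vertex [simp]: "order (insert_vertex H t) = Suc (order H)"
  by (simp add: insert_vertex_def)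

lemma wf_insert_vertex:
  assumes "wf_ordered_graph H"
  shows "wf_ordered_graph (insert_vertex H t)"
  using assms card_image[OF inj_on_subset[OF inj_skip subset_UNIV]]
  by (fastforce simp: wf_ordered_graph_def insert_vertex_def vertices_def skip_def)

lemma card_edges_insert_vertex_le:
  assumes "wf_ordered_graph H"
  shows "card (edges (insert_vertex H t)) \<le> card (edges H)"
  unfolding insert_vertex_def using card_image_le[OF finite_edges[OF assms]] by simp

text \<open>The two shifts differ only on s, ..., t - 1, which lies in the block and meets no edge.
  Hence any vertex of the enlarged block may be regarded as the inserted one.\<close>

lemma insert_vertex_eq:
  assumes "isolated_block H s k" "t \<in> {s..s + k}"
  shows "insert_vertex H s = insert_vertex H t"
proof -
  have "skip s ` e = skip t ` e" if "e \<in> edges H" for e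
  proof (rule image_cong)
    fix x assume "x \<in> e"
    then have "x \<notin> {s..<s + k}"
      using assms(1) that unfolding isolated_block_def by blast
    then show "skip s x = skip t x"
      using assms(2) by (auto simp: skip_def)
  qed simp
  then show ?thesis
    by (simp add: insert_vertex_def cong: image_cong)
qed

lemma isolated_block_insert_vertex:
  assumes "isolated_block H s k"
  shows "isolated_block (insert_vertex H s) s k"
  using assms unfolding isolated_block_def
  by (fastforce simp: insert_vertex_def skip_def split: if_splits)

text \<open>Deleting any vertex of the enlarged block gives back H. Choosing one that a supposed
  copy misses leaves the copy intact.\<close>

lemma insert_vertex_avoids:
  assumes "isolated_block H s (order G)" "\<not> contains H G"
  shows "\<not> contains (insert_vertex H s) G"
proof
  let ?k = "order G"
  assume "contains (insert_vertex H s) G"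
  then obtain \<phi> where \<phi>: "\<phi> ` {1..?k} \<subseteq> {1..Suc (order H)}" "strict_mono_on {1..?k} \<phi>"
    "\<And>u v. {u, v} \<in> edges G \<Longrightarrow> {\<phi> u, \<phi> v} \<in> edges (insert_vertex H s)"
    unfolding contains_def vertices_def by auto
  \<comment> \<open>A copy of \<open>G\<close> has too few vertices to fill the enlarged block.\<close>
  have "\<not> {s..s + ?k} \<subseteq> \<phi> ` {1..?k}"
  proof
    assume "{s..s + ?k} \<subseteq> \<phi> ` {1..?k}"
    then have "card {s..s + ?k} \<le> card {1..?k}"
      by (rule surj_card_le[rotated]) simp
    then show False by simp
  qed
  then obtain t where t: "t \<in> {s..s + ?k}" "t \<notin> \<phi> ` {1..?k}" by blast
  have ts: "1 \<le> t" "t \<le> Suc (order H)"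
    using t assms(1) by (auto simp: isolated_block_def)
  have ne: "\<phi> i \<noteq> t" if "i \<in> {1..?k}" for i
    using t(2) that by blast
  have "unskip t (\<phi> i) \<in> {1..order H}" if "i \<in> {1..?k}" for i
  proof -
    have "\<phi> i \<in> {1..Suc (order H)}" using \<phi>(1) that by blast
    with ne[OF that] ts show ?thesis by (auto simp: unskip_def)
  qed
  moreover have "strict_mono_on {1..?k} (unskip t \<circ> \<phi>)"
  proof (rule strict_mono_onI)
    fix i j assume ij: "i \<in> {1..?k}" "j \<in> {1..?k}" "i < j"
    then have "\<phi> i < \<phi> j" by (intro strict_mono_onD[OF \<phi>(2)])
    with ne[OF ij(1)] ne[OF ij(2)] show "(unskip t \<circ> \<phi>) i < (unskip t \<circ> \<phi>) j"
      by (auto simp: unskip_def)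
  qed
  moreover have "{unskip t (\<phi> i), unskip t (\<phi> j)} \<in> edges H" if ij: "{i, j} \<in> edges G" for i j
  proof -
    obtain e where e: "e \<in> edges H" "{\<phi> i, \<phi> j} = skip t ` e"
      using \<phi>(3)[OF ij] insert_vertex_eq[OF assms(1) t(1)] by (auto simp: insert_vertex_def)
    then have "unskip t ` {\<phi> i, \<phi> j} = e"
      by (simp only: image_image unskip_skip) simp
    with e(1) show ?thesis by simp
  qed
  ultimately have "contains H G"
    unfolding contains_def by (intro exI[of _ "unskip t \<circ> \<phi>"]) (auto simp: vertices_def)
  with assms(2) show False ..
qed

text \<open>The enlarged block has at least three vertices, so some t in it is neither x nor y.
  Delete t, use saturation of H for the remaining pair, and carry the resulting copy back along
  \<open>skip t\<close>.\<close>

lemma saturates_insert_vertex: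
  assumes block: "isolated_block H s (order G)" and sat: "saturates H G" and "2 \<le> order G"
  shows "saturates (insert_vertex H s) G"
proof -
  have "contains (add_edge (insert_vertex H s) x y) G"
    if xy: "x \<in> {1..Suc (order H)}" "y \<in> {1..Suc (order H)}" "x \<noteq> y"
      "{x, y} \<notin> edges (insert_vertex H s)" for x y
  proof -
    obtain t where t: "t \<in> {s..s + order G}" "t \<noteq> x" "t \<noteq> y"
    proof -
      have "\<not> {s..s + order G} \<subseteq> {x, y}"
      proof
        assume "{s..s + order G} \<subseteq> {x, y}"
        then have "card {s..s + order G} \<le> card {x, y}"
          by (intro card_mono) auto
        with xy(3) assms(3) show False by simp
      qed
      with that show ?thesis by blast
    qed
    have ts: "1 \<le> t" "t \<le> Suc (order H)"
      using t block by (auto simp: isolated_block_def)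
    have eq: "insert_vertex H s = insert_vertex H t"
      by (rule insert_vertex_eq[OF block t(1)])
    let ?x = "unskip t x" and ?y = "unskip t y"
    have skip: "skip t ?x = x" "skip t ?y = y"
      using t by (auto simp: skip_unskip)
    have "?x \<in> {1..order H}" "?y \<in> {1..order H}"
      using xy(1,2) t ts by (auto simp: unskip_def)
    moreover have "?x \<noteq> ?y"
      using skip xy(3) by metis
    moreover have "{?x, ?y} \<notin> edges H"
    proof
      assume "{?x, ?y} \<in> edges H"
      then have "skip t ` {?x, ?y} \<in> edges (insert_vertex H t)"
        unfolding insert_vertex_def by (simp del: image_insert)
      with xy(4) eq skip show False by simp
    qed
    ultimately have "contains (add_edge H ?x ?y) G"
      using sat by (simp add: saturates_def vertices_def)
    then show ?thesis
    proof (rule contains_map[where f = "skip t"])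
      show "skip t ` vertices (add_edge H ?x ?y) \<subseteq> vertices (add_edge (insert_vertex H s) x y)"
        by (auto simp: vertices_def add_edge_def skip_def)
      show "strict_mono_on (vertices (add_edge H ?x ?y)) (skip t)"
        using strict_mono_skip by (auto simp: strict_mono_on_def strict_mono_def)
      fix a b assume "{a, b} \<in> edges (add_edge H ?x ?y)"
      then have "skip t ` {a, b} \<in> insert (skip t ` {?x, ?y}) ((`) (skip t) ` edges H)"
        by (auto simp: add_edge_def simp del: image_insert)
      then show "{skip t a, skip t b} \<in> edges (add_edge (insert_vertex H s) x y)"
        using skip eq by (simp add: add_edge_def insert_vertex_def)
    qed
  qed
  with insert_vertex_avoids[OF block] sat show ?thesis
    unfolding saturates_def by (simp add: vertices_def)
qed

lemma sat_le_if_isolated_block: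
  assumes "wf_ordered_graph H" "saturates H G" "isolated_block H s (order G)" "2 \<le> order G"
    and "order H \<le> n"
  shows "sat n G \<le> card (edges H)"
proof -
  \<comment> \<open>The block is kept in the induction claim, at the same position s, so that the
    insertion can be repeated.\<close>
  have "\<exists>H'. wf_ordered_graph H' \<and> saturates H' G \<and> isolated_block H' s (order G) \<and>
    order H' = n \<and> card (edges H') \<le> card (edges H)"
    using assms(5)
  proof (induction n rule: dec_induct)
    case base
    with assms show ?case by blast
  next
    case (step m)
    then obtain H' where "wf_ordered_graph H'" "saturates H' G" "isolated_block H' s (order G)"
      "order H' = m" "card (edges H') \<le> card (edges H)" by blast
    with assms(4) show ?case
      by (intro exI[of _ "insert_vertex H' s"])
        (auto intro: wf_insert_vertex saturates_insert_vertex isolated_block_insert_vertex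
          order_trans[OF card_edges_insert_vertex_le])
  qed
  then show ?thesis
    using sat_le by (metis order_trans)
qed

section \<open>The linear lower bound and the dichotomy\<close>

text \<open>Cut the vertices into disjoint intervals of length k. Each contains an endpoint of some
  edge, and m edges have at most 2 * m endpoints.\<close>

lemma card_edges_ge_if_no_isolated_block:
  assumes "wf_ordered_graph H" "\<And>s. \<not> isolated_block H s k"
  shows "order H div k \<le> 2 * card (edges H)"
proof -
  let ?m = "order H div k"
  have "\<exists>x\<in>\<Union>(edges H). x \<in> {Suc (j * k)..<Suc (j * k) + k}" if "j < ?m" for j
  proof -
    have "Suc j * k \<le> ?m * k"
      using that by (intro mult_right_mono) auto
    also have "\<dots> \<le> order H" by simp
    finally have "Suc (j * k) + k \<le> Suc (order H)" by simp
    with assms(2)[of "Suc (j * k)"] show ?thesis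
      unfolding isolated_block_def by fastforce
  qed
  then obtain w where w: "w j \<in> \<Union>(edges H)" "w j \<in> {Suc (j * k)..<Suc (j * k) + k}"
    if "j < ?m" for j
    by metis
  \<comment> \<open>The chosen endpoint determines its interval, so w is injective; the shift by 1
    is there because vertices are numbered from 1.\<close>
  have "(w j - 1) div k = j" if "j < ?m" for j
    using w(2)[OF that] by (intro div_nat_eqI) (auto simp: mult.commute)
  then have "inj_on w {..<?m}"
    by (metis inj_onI lessThan_iff)
  moreover have fin: "finite (\<Union>(edges H))"
    by (rule finite_subset[of _ "vertices H"])
      (use assms(1) in \<open>auto simp: wf_ordered_graph_def vertices_def\<close>)
  ultimately have "card {..<?m} \<le> card (\<Union>(edges H))"
    using w(1) by (intro card_inj_on_le) auto
  also have "\<dots> \<le> (\<Sum>e\<in>edges H. card e)"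
    using card_UN_le[OF finite_edges[OF assms(1)], of "\<lambda>e. e"] by simp
  also have "\<dots> = 2 * card (edges H)"
    using assms(1) by (simp add: wf_ordered_graph_def)
  finally show ?thesis by simp
qed

theorem theorem1:
  fixes G :: ordered_graph
  assumes "wf_ordered_graph G"
    and "edges G \<noteq> {}"
  shows "(\<lambda>n. real (sat n G)) \<in> O(\<lambda>n. 1) \<or> (\<lambda>n. real (sat n G)) \<in> \<Theta>(\<lambda>n. real n)"
proof -
  let ?k = "order G"
  obtain e where "e \<in> edges G" using assms(2) by blast
  then obtain x y where "1 \<le> x" "x < y" "y \<le> ?k"
    using wf_ordered_graph_edgeE[OF assms(1)] by metis
  then have k: "2 \<le> ?k" by simp
  show ?thesis
  proof (cases "\<exists>H s. wf_ordered_graph H \<and> saturates H G \<and> isolated_block H s ?k")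
    case True
    then obtain H s where H: "wf_ordered_graph H" "saturates H G" "isolated_block H s ?k"
      by blast
    have "(\<lambda>n. real (sat n G)) \<in> O(\<lambda>n. 1)"
      using sat_le_if_isolated_block[OF H k]
      by (intro bigoI[of _ "real (card (edges H))"] eventually_sequentiallyI[of "order H"]) auto
    then show ?thesis ..
  next
    case False
    have upper: "(\<lambda>n. real (sat n G)) \<in> O(\<lambda>n. real n)"
    proof (intro bigoI[of _ "real (3 * ?k)"] always_eventually allI)
      fix n
      have "real (sat n G) \<le> real (3 * ?k * n)"
        using sat_le_linear[OF assms] by (simp only: of_nat_le_iff)
      then show "norm (real (sat n G)) \<le> real (3 * ?k) * norm (real n)"
        by simp
    qed
    \<comment> \<open>Counting gives n < 2 * \<open>sat n G\<close> * k + k with k =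
      \<open>order G\<close>. For n at least 2 * k the last summand is at most n / 2, and absorbing
      it doubles the constant to 4 * k.\<close>
    have "(\<lambda>n. real n) \<in> O(\<lambda>n. real (sat n G))"
    proof (intro bigoI[of _ "real (4 * ?k)"] eventually_sequentiallyI[of "2 * ?k"])
      fix n assume n: "2 * ?k \<le> n"
      obtain H where H: "wf_ordered_graph H" "order H = n" "saturates H G"
        "card (edges H) = sat n G"
        using sat_attained[OF assms] by blast
      have "n div ?k \<le> 2 * sat n G"
        using card_edges_ge_if_no_isolated_block[OF H(1), of ?k] False H by auto
      then have "(n div ?k) * ?k \<le> 2 * sat n G * ?k"
        by (rule mult_right_mono) simp
      moreover have "n = (n div ?k) * ?k + n mod ?k" by simp
      moreover have "n mod ?k < ?k" using k by simp
      ultimately have "n \<le> 2 * (2 * sat n G * ?k)"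
        using n by linarith
      then have "n \<le> 4 * ?k * sat n G"
        by (simp add: algebra_simps)
      then have "real n \<le> real (4 * ?k * sat n G)"
        by (simp only: of_nat_le_iff)
      then show "norm (real n) \<le> real (4 * ?k) * norm (real (sat n G))"
        by simp
    qed
    with upper have "(\<lambda>n. real (sat n G)) \<in> \<Theta>(\<lambda>n. real n)"
      by (simp add: bigtheta_def bigomega_iff_bigo)
    then show ?thesis ..
  qed
qed

end
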